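(* There exist unit circular-arc graphs that do not have a $2$-dot product representation.
   Context: Graphs are finite and simple. A unit circular-arc graph is the intersection graph of a finite collection of unit-length (i.e. equal-length, closed) arcs of a circle: the vertices are the arcs, and two distinct vertices are adjacent if and only if the corresponding arcs intersect. A $2$-dot product representation of a graph $G=(V,E)$ is an assignment of vectors $\mathbf{a}^u\in\mathbb{R}^2$ ($u\in V$) together with a threshold $t>0$ such that, for all distinct $u,v\in V$, $uv\in E$ if and only if $\mathbf{a}^u\cdot\mathbf{a}^v\ge t$ (one may take $t=1$ by scaling). *)

theory Defs
  imports "HOL-Analysis.Analysis" "Graph_Theory.Pair_Digraph"
begin

text \<open>A finite simple graph is a \<open>pair_graph\<close>: finitely many vertices, and an irreflexive
  symmetric set of ordered pairs of vertices as arcs. The edge \<open>uv\<close> is present iff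
  \<open>(u, v) \<in> parcs G\<close>.\<close>

text \<open>Closed arcs of length 1 on the circle with centre \<open>c\<close> and radius \<open>r\<close>: at radius \<open>r\<close>,
  arc length 1 corresponds to the angle \<open>1 / r\<close>.\<close>

definition unit_arc :: "complex \<Rightarrow> real \<Rightarrow> complex set \<Rightarrow> bool" where
  "unit_arc c r A \<longleftrightarrow> (\<exists>s. A = (\<lambda>x. c + of_real r * cis x) ` {s .. s + 1 / r})"

text \<open>The circumference exceeds 1, so that a unit arc is a proper arc that does not overlap
  itself. Distinct vertices may be assigned the same arc.\<close>

definition unit_circular_arc_graph :: "'v pair_pre_digraph \<Rightarrow> bool" where
  "unit_circular_arc_graph G \<longleftrightarrow>
     (\<exists>c r A. 2 * pi * r > 1 \<and>
        (\<forall>v\<in>pverts G. unit_arc c r (A v)) \<and>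
        (\<forall>u\<in>pverts G. \<forall>v\<in>pverts G. u \<noteq> v \<longrightarrow>
           ((u, v) \<in> parcs G \<longleftrightarrow> A u \<inter> A v \<noteq> {})))"

definition dot_product_representation ::
    "'v pair_pre_digraph \<Rightarrow> ('v \<Rightarrow> real ^ 'k) \<Rightarrow> real \<Rightarrow> bool" where
  "dot_product_representation G a t \<longleftrightarrow>
     t > 0 \<and>
     (\<forall>u\<in>pverts G. \<forall>v\<in>pverts G. u \<noteq> v \<longrightarrow>
        ((u, v) \<in> parcs G \<longleftrightarrow> a u \<bullet> a v \<ge> t))"

end

theory Submission
  imports Defs
begin

text \<open>The witness is the square of the 7-cycle, realised by seven equally spaced arcs of angle
  \<open>5\<pi>/7\<close>. In a representation, Lagrange's identity
  \<open>(w \<times> x)(b \<times> y) = (w \<bullet> b)(x \<bullet> y) - (w \<bullet> y)(b \<bullet> x)\<close> makes the sign of the planar cross product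
  of \<open>a\<^sub>i\<close> and \<open>a\<^sub>i\<^sub>+\<^sub>2\<close> change when \<open>i\<close> increases by 3. Seven such steps lead back to \<open>i\<close>, and seven
  is odd.\<close>

definition cross2 :: "real ^ 2 \<Rightarrow> real ^ 2 \<Rightarrow> real" where
  "cross2 x y = x $ 1 * y $ 2 - x $ 2 * y $ 1"

lemma inner_real2: "x \<bullet> y = x $ 1 * y $ 1 + x $ 2 * y $ 2" for x y :: "real ^ 2"
  by (simp add: inner_vec_def sum_2)

lemma cross2_mult: "cross2 w x * cross2 b y = (w \<bullet> b) * (x \<bullet> y) - (w \<bullet> y) * (b \<bullet> x)"
  by (simp add: cross2_def inner_real2 algebra_simps)

text \<open>\<open>(cross2 w b)\<^sup>2\<close> is the Gram determinant of \<open>w\<close> and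
  \<open>b\<close>. When it is nonzero, \<open>x\<close> and \<open>y\<close> are determined by
  their inner products with \<open>w\<close> and \<open>b\<close>, and the inverse Gram matrix gives
  \<open>x \<bullet> y\<close> in these coordinates; clearing the denominator leaves a polynomial
  identity.\<close>

lemma cross2_power2_mult_inner:
  "(cross2 w b)\<^sup>2 * (x \<bullet> y) =
     (w \<bullet> x) * (w \<bullet> y) * (b \<bullet> b) + (b \<bullet> x) * (b \<bullet> y) * (w \<bullet> w)
     - (w \<bullet> b) * ((w \<bullet> x) * (b \<bullet> y) + (b \<bullet> x) * (w \<bullet> y))"
  by (simp add: cross2_def inner_real2 power2_eq_square algebra_simps)

text \<open>The dual cone of an obtuse cone in the plane is acute. Algebraically, the obtuse angle
  makes the mixed term of the Gram identity contribute strictly positively, and a positive product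
  with a square as one factor has a positive other factor.\<close>

lemma inner_pos_if_dual_obtuse:
  fixes w b x y :: "real ^ 2"
  assumes "w \<bullet> b < 0" and "w \<bullet> x > 0" "w \<bullet> y > 0" "b \<bullet> x > 0" "b \<bullet> y > 0"
  shows "x \<bullet> y > 0"
proof -
  have "(w \<bullet> b) * ((w \<bullet> x) * (b \<bullet> y) + (b \<bullet> x) * (w \<bullet> y)) < 0"
    using assms by (intro mult_neg_pos add_pos_pos mult_pos_pos)
  moreover have "(w \<bullet> x) * (w \<bullet> y) * (b \<bullet> b) \<ge> 0" "(b \<bullet> x) * (b \<bullet> y) * (w \<bullet> w) \<ge> 0"
    using assms by simp_all
  ultimately have "(cross2 w b)\<^sup>2 * (x \<bullet> y) > 0"
    unfolding cross2_power2_mult_inner by linarith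
  then show ?thesis
    by (simp add: zero_less_mult_iff not_less)
qed

text \<open>The hypotheses describe an induced 4-cycle w, x, b, y whose diagonals are the non-edges.
  In Lagrange's identity the side product is at least \<open>t * t\<close>, so the diagonal product
  has to stay below that. The only danger is two very negative diagonals, which the dual cone
  argument excludes.\<close>

lemma cross2_mult_neg:
  fixes w b x y :: "real ^ 2"
  assumes "t > 0" and "w \<bullet> b < t" "x \<bullet> y < t"
    and ge: "w \<bullet> x \<ge> t" "w \<bullet> y \<ge> t" "b \<bullet> x \<ge> t" "b \<bullet> y \<ge> t"
  shows "cross2 w x * cross2 b y < 0"
proof -
  have "t * t \<le> (w \<bullet> y) * (b \<bullet> x)"
    using ge \<open>t > 0\<close> by (intro mult_mono) auto
  moreover have "(w \<bullet> b) * (x \<bullet> y) < t * t"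
  proof (cases "w \<bullet> b < 0")
    case True
    then have "x \<bullet> y > 0"
      by (rule inner_pos_if_dual_obtuse) (use ge \<open>t > 0\<close> in linarith)+
    then have "(w \<bullet> b) * (x \<bullet> y) < 0"
      using True by (simp add: mult_neg_pos)
    then show ?thesis
      using \<open>t > 0\<close> by (meson less_trans mult_pos_pos)
  next
    case False
    then have "(w \<bullet> b) * (x \<bullet> y) \<le> (w \<bullet> b) * t"
      using \<open>x \<bullet> y < t\<close> by (intro mult_left_mono) auto
    also have "\<dots> < t * t"
      using assms by simp
    finally show ?thesis .
  qed
  ultimately show ?thesis
    unfolding cross2_mult by linarith
qed

lemma arcs_intersect_iff:
  assumes "r > 0" and "l \<ge> 0"
  shows "(\<lambda>x. c + of_real r * cis x) ` {s..s + l} \<inter> (\<lambda>x. c + of_real r * cis x) ` {t..t + l} \<noteq> {} \<longleftrightarrow>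
    (\<exists>k::int. \<bar>s - t - 2 * pi * k\<bar> \<le> l)"
proof -
  have "(\<lambda>x. c + of_real r * cis x) ` {s..s + l} \<inter> (\<lambda>x. c + of_real r * cis x) ` {t..t + l} \<noteq> {} \<longleftrightarrow>
      (\<exists>x\<in>{s..s + l}. \<exists>y\<in>{t..t + l}. cis x = cis y)"
    using \<open>r > 0\<close> by auto
  also have "\<dots> \<longleftrightarrow> (\<exists>x\<in>{s..s + l}. \<exists>y\<in>{t..t + l}. \<exists>k::int. x = y + 2 * pi * k)"
    by (simp only: complex_eq_iff cis.sel flip: sin_cos_eq_iff) (simp only: conj_commute)
  also have "\<dots> \<longleftrightarrow> (\<exists>k::int. \<bar>s - t - 2 * pi * k\<bar> \<le> l)"
  proof safe
    fix k :: int assume k: "\<bar>s - t - 2 * pi * k\<bar> \<le> l"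
    \<comment> \<open>After the first angle interval is moved back by \<open>k\<close> turns, this
      is the left end of the overlap.\<close>
    define y where "y = max t (s - 2 * pi * k)"
    have "y \<in> {t..t + l}" "y + 2 * pi * k \<in> {s..s + l}"
      using k \<open>l \<ge> 0\<close> unfolding y_def by auto
    then show "\<exists>x\<in>{s..s + l}. \<exists>y\<in>{t..t + l}. \<exists>k::int. x = y + 2 * pi * k"
      by blast
  next
    fix y and k :: int
    assume "y \<in> {t..t + l}" "y + 2 * pi * k \<in> {s..s + l}"
    then have "\<bar>s - t - 2 * pi * k\<bar> \<le> l"
      by (auto simp: abs_le_iff)
    then show "\<exists>k::int. \<bar>s - t - 2 * pi * k\<bar> \<le> l" ..
  qed
  finally show ?thesis .
qed

text \<open>Cyclic distance is expressed through an integer number of turns \<open>k\<close>, so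
  that adjacency matches the criterion of \<open>arcs_intersect_iff\<close> term by term.\<close>

definition cycle7_square :: "nat pair_pre_digraph" where
  "cycle7_square = \<lparr>pverts = {..<7},
     parcs = {(i, j). i < 7 \<and> j < 7 \<and> i \<noteq> j \<and> (\<exists>k::int. \<bar>int i - int j - 7 * k\<bar> \<le> 2)}\<rparr>"

lemma pair_graph_cycle7_square: "pair_graph cycle7_square"
proof
  have "parcs cycle7_square \<subseteq> {..<7} \<times> {..<7}"
    by (auto simp: cycle7_square_def)
  then show "finite (parcs cycle7_square)"
    by (rule finite_subset) simp
next
  have "\<exists>k. \<bar>int j - int i - 7 * k\<bar> \<le> 2" if "\<bar>int i - int j - 7 * k\<bar> \<le> 2" for i j k
    using that by (intro exI[of _ "-k"]) linarith
  then show "symmetric (with_proj cycle7_square)"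
    by (auto simp: symmetric_def cycle7_square_def image_iff sym_def)
qed (auto simp: cycle7_square_def)

lemma unit_circular_arc_graph_cycle7_square: "unit_circular_arc_graph cycle7_square"
proof -
  \<comment> \<open>The arc then spans the angle \<open>5 * pi / 7\<close>, which is two and a half
    times the spacing \<open>2 * pi / 7\<close>: arcs two places apart meet, arcs three places apart
    do not.\<close>
  define r :: real where "r = 7 / (5 * pi)"
  define A where "A = (\<lambda>i::nat. (\<lambda>x. 0 + of_real r * cis x) ` {2 * pi * i / 7 .. 2 * pi * i / 7 + 1 / r})"
  have r: "r > 0" "2 * pi * r > 1" "1 / r = 5 * pi / 7"
    by (simp_all add: r_def)
  have dist: "\<bar>2 * pi * i / 7 - 2 * pi * j / 7 - 2 * pi * k\<bar> \<le> 1 / r \<longleftrightarrow> \<bar>int i - int j - 7 * k\<bar> \<le> 2"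
    for i j :: nat and k :: int
  proof -
    define n where "n = int i - int j - 7 * k"
    \<comment> \<open>In units of \<open>pi / 7\<close> both sides of the comparison are integers,
      and 2|n| \<le> 5 amounts to |n| \<le> 2.\<close>
    have "2 * pi * i / 7 - 2 * pi * j / 7 - 2 * pi * k = pi / 7 * of_int (2 * n)"
      by (simp add: n_def field_simps)
    then have "\<bar>2 * pi * i / 7 - 2 * pi * j / 7 - 2 * pi * k\<bar> = pi / 7 * of_int \<bar>2 * n\<bar>"
      by (metis abs_mult abs_of_pos divide_pos_pos of_int_abs pi_gt_zero zero_less_numeral)
    moreover have "1 / r = pi / 7 * of_int 5"
      unfolding r(3) by (metis mult.commute of_int_numeral times_divide_eq_right)
    ultimately have "\<bar>2 * pi * i / 7 - 2 * pi * j / 7 - 2 * pi * k\<bar> \<le> 1 / r \<longleftrightarrow>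
        pi / 7 * of_int \<bar>2 * n\<bar> \<le> pi / 7 * of_int 5"
      by (rule arg_cong2)
    also have "\<dots> \<longleftrightarrow> (of_int \<bar>2 * n\<bar> :: real) \<le> of_int 5"
      by (rule mult_le_cancel_left_pos) simp
    also have "\<dots> \<longleftrightarrow> \<bar>n\<bar> \<le> 2"
      unfolding of_int_le_iff by presburger
    also have "\<dots> \<longleftrightarrow> \<bar>int i - int j - 7 * k\<bar> \<le> 2"
      by (simp only: n_def)
    finally show ?thesis .
  qed
  have arcs: "unit_arc 0 r (A i)" for i
    unfolding unit_arc_def A_def by blast
  have meet: "A i \<inter> A j \<noteq> {} \<longleftrightarrow> (\<exists>k::int. \<bar>int i - int j - 7 * k\<bar> \<le> 2)" for i j
    unfolding A_def using r(1) by (simp only: arcs_intersect_iff dist zero_le_divide_1_iff less_imp_le)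
  show ?thesis
    unfolding unit_circular_arc_graph_def
  proof (rule exI[of _ 0], rule exI[of _ r], rule exI[of _ A], intro conjI ballI impI)
    fix i j assume "i \<in> pverts cycle7_square" "j \<in> pverts cycle7_square" "i \<noteq> j"
    then show "(i, j) \<in> parcs cycle7_square \<longleftrightarrow> A i \<inter> A j \<noteq> {}"
      unfolding meet by (simp add: cycle7_square_def)
  qed (rule r(2), rule arcs)
qed

lemma not_dot_product_representation_cycle7_square:
  fixes a :: "nat \<Rightarrow> real ^ 2"
  shows "\<not> dot_product_representation cycle7_square a t"
proof
  assume rep: "dot_product_representation cycle7_square a t"
  then have "t > 0"
    by (simp add: dot_product_representation_def)
  have adj: "a i \<bullet> a j \<ge> t \<longleftrightarrow> (\<exists>k::int. \<bar>int i - int j - 7 * k\<bar> \<le> 2)"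
    if "i < 7" "j < 7" "i \<noteq> j" for i j
    using rep that by (auto simp: dot_product_representation_def cycle7_square_def)
  \<comment> \<open>Rotation invariance: reducing indices modulo 7 lets \<open>i\<close> run through
    all naturals, so the walk in steps of 3 needs no separate treatment of wrap-around. Below,
    \<open>q\<close> counts the turns that the reduction drops.\<close>
  have shift: "a (i mod 7) \<bullet> a ((i + d) mod 7) \<ge> t \<longleftrightarrow> (\<exists>k::int. \<bar>int d - 7 * k\<bar> \<le> 2)"
    if "d mod 7 \<noteq> 0" for i d
  proof -
    define q where "q = int ((i + d) div 7) - int (i div 7)"
    have diff: "int (i mod 7) - int ((i + d) mod 7) = 7 * q - int d"
      unfolding q_def by (simp add: zmod_int zdiv_int minus_div_mult_eq_mod[symmetric])
    have "i mod 7 \<noteq> (i + d) mod 7"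
    proof
      assume "i mod 7 = (i + d) mod 7"
      then have "int d = 7 * q"
        using diff by simp
      then have "7 dvd d"
        by (metis dvd_triv_left int_dvd_int_iff of_nat_numeral)
      with that show False
        by simp
    qed
    then have "a (i mod 7) \<bullet> a ((i + d) mod 7) \<ge> t \<longleftrightarrow> (\<exists>k::int. \<bar>7 * q - int d - 7 * k\<bar> \<le> 2)"
      by (subst adj) (simp_all add: diff)
    also have "\<dots> \<longleftrightarrow> (\<exists>k::int. \<bar>int d - 7 * k\<bar> \<le> 2)"
    proof safe
      fix k assume "\<bar>7 * q - int d - 7 * k\<bar> \<le> 2"
      then show "\<exists>k::int. \<bar>int d - 7 * k\<bar> \<le> 2"
        by (intro exI[of _ "q - k"]) presburger
    next
      fix k assume "\<bar>int d - 7 * k\<bar> \<le> 2"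
      then show "\<exists>k::int. \<bar>7 * q - int d - 7 * k\<bar> \<le> 2"
        by (intro exI[of _ "q - k"]) presburger
    qed
    finally show ?thesis .
  qed
  have near1: "a (i mod 7) \<bullet> a ((i + 1) mod 7) \<ge> t" for i
    by (subst shift) (auto intro: exI[of _ 0])
  have near2: "a (i mod 7) \<bullet> a ((i + 2) mod 7) \<ge> t" for i
    by (subst shift) (auto intro: exI[of _ 0])
  \<comment> \<open>Here 5 stands for -2 modulo 7, hence the witness 1.\<close>
  have near5: "a (i mod 7) \<bullet> a ((i + 5) mod 7) \<ge> t" for i
    by (subst shift) (auto intro: exI[of _ 1])
  have "\<not> (\<exists>k::int. \<bar>int 3 - 7 * k\<bar> \<le> 2)"
    by presburger
  then have far: "a (i mod 7) \<bullet> a ((i + 3) mod 7) < t" for i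
    using shift[of 3 i] by simp
  define f where "f = (\<lambda>i. cross2 (a (i mod 7)) (a ((i + 2) mod 7)))"
  \<comment> \<open>The induced 4-cycle is i, i+2, i+3, i+5 modulo 7: its sides have differences 2,
    1, 2, 5 and both diagonals have difference 3.\<close>
  have neg: "f i * f (i + 3) < 0" for i
    unfolding f_def
  proof (rule cross2_mult_neg[OF \<open>t > 0\<close>])
    show "a ((i + 2) mod 7) \<bullet> a ((i + 3 + 2) mod 7) < t"
      using far[of "i + 2"] by (simp add: add.assoc)
    show "a (i mod 7) \<bullet> a ((i + 3 + 2) mod 7) \<ge> t"
      using near5[of i] by (simp add: ac_simps)
    show "a ((i + 3) mod 7) \<bullet> a ((i + 2) mod 7) \<ge> t"
      using near1[of "i + 2"] by (simp add: ac_simps inner_commute)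
  qed (fact far near2)+
  \<comment> \<open>The strict inequality \<open>neg\<close> also rules out the value 0, so failing
    to be positive means being negative.\<close>
  have step: "f (i + 3) > 0 \<longleftrightarrow> \<not> f i > 0" for i
    using neg[of i] by (auto simp: mult_less_0_iff)
  have "f 21 > 0 \<longleftrightarrow> \<not> f 0 > 0"
    using step[of 0] step[of 3] step[of 6] step[of 9] step[of 12] step[of 15] step[of 18] by simp
  moreover have "f 21 = f 0"
    by (simp add: f_def numeral_2_eq_2)
  ultimately show False
    by simp
qed

theorem theorem12:
  shows "\<exists>G :: nat pair_pre_digraph.
           pair_graph G \<and> unit_circular_arc_graph G \<and>
           \<not> (\<exists>(a :: nat \<Rightarrow> real ^ 2) t. dot_product_representation G a t)"
  using pair_graph_cycle7_square unit_circular_arc_graph_cycle7_square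
    not_dot_product_representation_cycle7_square by blast

end
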